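(* For all $n \ge 16$, $$N_{1,4}(n) = N_{1,4}(n-3)+N_{1,4}(n-5)+N_{1,4}(n-7)+N_{1,4}(n-8)+N_{1,4}(n-9)+N_{1,4}(n-10)+N_{1,4}(n-11)+N_{1,4}(n-13),$$ with initial values $N_{1,4}(n)=0$ for $n<5$ and $N_{1,4}(5)=1$, $N_{1,4}(6)=0$, $N_{1,4}(7)=1$, $N_{1,4}(8)=1$, $N_{1,4}(9)=1$, $N_{1,4}(10)=3$, $N_{1,4}(11)=2$, $N_{1,4}(12)=3$, $N_{1,4}(13)=6$, $N_{1,4}(14)=5$, $N_{1,4}(15)=10$.
   Context: For positive integers $a<b$ and $n \ge 3$, an $(a,b)$-necklace of length $n$ is a circular arrangement of the integers $0,1,\ldots,n-1$ (each used exactly once) such that any two adjacent entries have difference $\pm a$ or $\pm b$. Two necklaces are considered the same if one is obtained from the other by rotation or reflection. $N_{a,b}(n)$ denotes the number of distinct $(a,b)$-necklaces of length $n$; equivalently, it is the number of Hamiltonian cycles (as undirected subgraphs) of the graph on $\{0,1,\ldots,n-1\}$ in which $x,y$ are adjacent if and only if $|x-y| \in \{a,b\}$. *)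

theory Defs
  imports Main
begin

(* A list stands for the circular arrangement in which its last entry is followed by its
   first.  Necklaces have length at least 3, so for n < 3 there are none. *)
definition necklace_word :: "nat \<Rightarrow> nat \<Rightarrow> nat \<Rightarrow> nat list \<Rightarrow> bool" where
  "necklace_word a b n xs \<longleftrightarrow>
     n \<ge> 3 \<and> distinct xs \<and> set xs = {0..<n} \<and>
     (\<forall>i<n. \<bar>int (xs ! i) - int (xs ! ((i + 1) mod n))\<bar> \<in> {int a, int b})"

definition same_necklace :: "'a list \<Rightarrow> 'a list \<Rightarrow> bool" where
  "same_necklace xs ys \<longleftrightarrow> (\<exists>k. ys = rotate k xs \<or> ys = rotate k (rev xs))"

definition necklaces :: "nat \<Rightarrow> nat \<Rightarrow> nat \<Rightarrow> nat list set set" where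
  "necklaces a b n =
     {xs. necklace_word a b n xs} //
     {(xs, ys). necklace_word a b n xs \<and> necklace_word a b n ys \<and> same_necklace xs ys}"

definition num_necklaces :: "nat \<Rightarrow> nat \<Rightarrow> nat \<Rightarrow> nat" where
  "num_necklaces a b n = card (necklaces a b n)"

end

theory Submission
  imports Defs
begin

text \<open>Remove the smallest vertex \<open>0\<close> from a Hamiltonian cycle and join its two neighbours by a link;
  renumbering gives a Hamiltonian cycle with one vertex less that must use the link. Counting
  Hamiltonian cycles with a prescribed set of links therefore obeys a recursion on the number of
  vertices. Starting from no links, links only ever join vertices among \<open>{0..3}\<close>, and just twelve
  sets of links occur, so the counts form a linear system of twelve sequences, in which the claimed
  recurrence is found by expansion. Reading a cycle from its largest vertex, which is never removed,
  picks exactly two words from each necklace.\<close>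

section \<open>Edges of words and of closed words\<close>

text \<open>Steps are sets, so orientation is forgotten. A cycle is handled by closing its word, as
  in \<open>steps (r # ys @ [r])\<close>.\<close>

fun steps :: "'a list \<Rightarrow> 'a set list" where
  "steps (x # y # zs) = {x, y} # steps (y # zs)"
| "steps zs = []"

lemma steps_append:
  "xs \<noteq> [] \<Longrightarrow> ys \<noteq> [] \<Longrightarrow> steps (xs @ ys) = steps xs @ {last xs, hd ys} # steps ys"
proof (induction xs rule: steps.induct)
  case (1 x y zs)
  then show ?case by simp
next
  case ("2_2" v)
  then show ?case by (cases ys) auto
qed auto

lemma length_steps [simp]: "length (steps xs) = length xs - 1"
  by (induction xs rule: steps.induct) auto

lemma steps_map: "steps (map f xs) = map ((`) f) (steps xs)"
  by (induction xs rule: steps.induct) auto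

lemma set_steps_rev: "set (steps (rev xs)) = set (steps xs)"
proof (induction xs rule: steps.induct)
  case (1 x y zs)
  have "steps ((rev zs @ [y]) @ [x]) = steps (rev zs @ [y]) @ {y, x} # steps [x]"
    by (subst steps_append) auto
  with 1 show ?case by auto
qed auto

lemma steps_nth: "Suc i < length xs \<Longrightarrow> steps xs ! i = {xs ! i, xs ! Suc i}"
proof (induction xs arbitrary: i rule: steps.induct)
  case (1 x y zs)
  then show ?case by (cases i) auto
qed auto

lemma steps_subset: "e \<in> set (steps xs) \<Longrightarrow> e \<subseteq> set xs"
  by (induction xs rule: steps.induct) auto

lemma card_steps: "distinct xs \<Longrightarrow> e \<in> set (steps xs) \<Longrightarrow> card e = 2"
  by (induction xs rule: steps.induct) auto

lemma distinct_steps: "distinct xs \<Longrightarrow> distinct (steps xs)"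
  by (induction xs rule: steps.induct) (auto dest: steps_subset)

text \<open>The second vertex \<open>y\<close> does not recur after the first step, so neither does
  \<open>{r, y}\<close>. With a single vertex besides \<open>r\<close>, the same edge would be
  walked twice; hence the length bound.\<close>

lemma distinct_steps_closed:
  assumes "distinct (r # ys)" "length ys \<ge> 2"
  shows "distinct (steps (r # ys @ [r]))"
proof -
  obtain y z zs where ys: "ys = y # z # zs"
    using assms(2) by (metis Suc_le_length_iff numeral_2_eq_2)
  have "{r, y} \<notin> set (steps (z # zs @ [r]))"
    using assms(1) steps_subset[of "{r, y}" "z # zs @ [r]"] by (auto simp: ys)
  moreover have "distinct (steps (y # z # zs @ [r]))"
    using assms(1) by (intro distinct_steps) (auto simp: ys)
  ultimately show ?thesis
    using assms(1) by (auto simp: ys doubleton_eq_iff)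
qed

text \<open>The edge of the closed cycle that is cut when its word is split into \<open>as\<close>
  and \<open>bs\<close>; \<open>r\<close> stands in as the endpoint next to an empty half.\<close>

definition gap :: "'a \<Rightarrow> 'a list \<Rightarrow> 'a list \<Rightarrow> 'a set" where
  "gap r as bs = {last (r # as), hd (bs @ [r])}"

lemma steps_gap:
  "steps (r # (as @ bs) @ [r]) = steps (r # as) @ gap r as bs # steps (bs @ [r])"
  using steps_append[of "r # as" "bs @ [r]"] by (simp add: gap_def)

text \<open>The steps of a closed cycle are distinct, so the cut edge determines its position, which
  is \<open>length as\<close>.\<close>

lemma gap_unique:
  assumes "distinct (r # as @ bs)" "length (as @ bs) \<ge> 2"
    and "as @ bs = as' @ bs'" "gap r as bs = gap r as' bs'"
  shows "as = as' \<and> bs = bs'"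
proof -
  let ?s = "steps (r # (as @ bs) @ [r])"
  have "?s ! length as = gap r as bs"
    unfolding steps_gap by (simp add: nth_append)
  moreover have "?s ! length as' = gap r as' bs'"
    unfolding assms(3) steps_gap by (simp add: nth_append)
  moreover have "length as < length ?s" "length as' < length ?s"
    using arg_cong[OF assms(3), of length] by auto
  ultimately have "length as = length as'"
    using nth_eq_iff_index_eq[OF distinct_steps_closed[OF assms(1,2)], of "length as" "length as'"]
      assms(4) by simp
  with assms(3) show ?thesis by simp
qed

lemma gap_exists:
  assumes "e \<in> set (steps (r # ys @ [r]))"
  obtains as bs where "ys = as @ bs" "gap r as bs = e"
proof -
  obtain i where i: "i < Suc (length ys)" "steps (r # ys @ [r]) ! i = e"
    using assms unfolding in_set_conv_nth by auto
  have "steps (r # (take i ys @ drop i ys) @ [r]) ! i = gap r (take i ys) (drop i ys)"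
    unfolding steps_gap using i(1) by (simp add: nth_append)
  with i(2) that[of "take i ys" "drop i ys"] show ?thesis by simp
qed

lemma card_gap:
  assumes "distinct (r # as @ bs)" "as @ bs \<noteq> []"
  shows "card (gap r as bs) = 2"
  using assms by (cases as rule: rev_cases; cases bs) (auto simp: gap_def)

section \<open>Cycles with links and the removal of the vertex 0\<close>

text \<open>The graph lives on all naturals; the word in \<open>rooted\<close> confines it to
  \<open>{0..r}\<close>.\<close>

definition edges :: "nat set set" where
  "edges = {{i, i + 1} |i. True} \<union> {{i, i + 4} |i. True}"

text \<open>\<open>ys\<close> stands for the cycle \<open>r # ys\<close> on \<open>{0..r}\<close>. The links \<open>L\<close> must all be used.\<close>

definition rooted :: "nat \<Rightarrow> nat set set \<Rightarrow> nat list set" where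
  "rooted r L = {ys. distinct ys \<and> set ys = {..<r} \<and> L \<subseteq> set (steps (r # ys @ [r])) \<and>
     set (steps (r # ys @ [r])) \<subseteq> edges \<union> L}"

text \<open>The next three definitions already use the numbering of the vertices after the removal of
  \<open>0\<close>: the links at \<open>0\<close> lead to \<open>nbr L\<close>, the other links become \<open>shift L\<close>, and \<open>gaps L\<close> are the
  possible pairs of neighbours of \<open>0\<close>. Its neighbours in the graph, 1 and 4, have become 0 and 3.
  A pair in \<open>shift L\<close> would close a cycle too early.\<close>

definition nbr :: "nat set set \<Rightarrow> nat set" where
  "nbr L = {j. {0, Suc j} \<in> L}"

definition shift :: "nat set set \<Rightarrow> nat set set" where
  "shift L = {e. Suc ` e \<in> L}"

definition gaps :: "nat set set \<Rightarrow> nat set set" where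
  "gaps L = {e. card e = 2 \<and> nbr L \<subseteq> e \<and> e \<subseteq> {0, 3} \<union> nbr L} - shift L"

text \<open>Undoes the removal of \<open>0\<close>: the cut between the two halves marks the link to
  be replaced by a passage through \<open>0\<close>.\<close>

definition insert0 :: "nat list \<times> nat list \<Rightarrow> nat list" where
  "insert0 p = map Suc (fst p) @ 0 # map Suc (snd p)"

lemma edge_iff: "{i, j} \<in> edges \<longleftrightarrow> \<bar>int i - int j\<bar> \<in> {1, 4}"
  unfolding edges_def by (auto simp: doubleton_eq_iff abs_if split: if_splits) presburger+

lemma Suc_image_edges: "card e = 2 \<Longrightarrow> Suc ` e \<in> edges \<longleftrightarrow> e \<in> edges"
  by (auto simp: card_2_iff edge_iff)

lemma zero_edge_iff: "{0, Suc j} \<in> edges \<longleftrightarrow> j \<in> {0, 3}"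
  unfolding edge_iff by auto

text \<open>Separates the edges at \<open>0\<close> from those that survive the removal and are
  merely renumbered.\<close>

lemma two_subset_cases:
  assumes "card e = 2"
  obtains (zero) j where "e = {0, Suc j}" | (image) f where "e = Suc ` f" "card f = 2"
proof -
  from assms obtain x y where e: "e = {x, y}" "x \<noteq> y" by (auto simp: card_2_iff)
  show thesis
  proof (cases "0 \<in> e")
    case True
    then show ?thesis using e zero by (metis insertE insert_commute not0_implies_Suc singletonD)
  next
    case False
    with e obtain a b where "x = Suc a" "y = Suc b" by (auto simp: gr0_conv_Suc)
    then show ?thesis using e image[of "{a, b}"] by auto
  qed
qed

text \<open>Such a word contains \<open>0\<close> exactly once, so cutting there and lowering the
  other entries inverts \<open>insert0\<close>.\<close>

lemma bij_insert0:
  "bij_betw insert0 {(as, bs). distinct (as @ bs) \<and> set (as @ bs) = {..<r}}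
     {ys. distinct ys \<and> set ys = {..<Suc r}}"
proof (rule bij_betw_imageI)
  show "inj_on insert0 {(as, bs). distinct (as @ bs) \<and> set (as @ bs) = {..<r}}"
  proof (rule inj_onI, clarsimp simp: insert0_def)
    fix as bs as' bs' :: "nat list"
    assume "map Suc as @ 0 # map Suc bs = map Suc as' @ 0 # map Suc bs'"
    then show "as = as' \<and> bs = bs'"
      by (subst (asm) append_Cons_eq_iff) (auto dest: map_injective)
  qed
  show "insert0 ` {(as, bs). distinct (as @ bs) \<and> set (as @ bs) = {..<r}} =
      {ys. distinct ys \<and> set ys = {..<Suc r}}" (is "?l = ?r")
  proof (intro equalityI subsetI)
    fix ys assume "ys \<in> ?l"
    then show "ys \<in> ?r"
      by (auto simp: insert0_def distinct_map lessThan_Suc_eq_insert_0 simp flip: image_Un)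
  next
    fix ys assume ys: "ys \<in> ?r"
    then obtain us vs where uv: "ys = us @ 0 # vs"
      by (metis (mono_tags) lessThan_iff mem_Collect_eq split_list zero_less_Suc)
    with ys have 0: "0 \<notin> set us" "0 \<notin> set vs" by auto
    define as bs where "as = map (\<lambda>x. x - 1) us" "bs = map (\<lambda>x. x - 1) vs"
    have "us = map Suc as" "vs = map Suc bs"
      using 0 by (auto simp: as_bs_def intro!: map_idI[symmetric]) (metis Suc_pred gr0I)+
    then have eq: "ys = insert0 (as, bs)" by (simp add: uv insert0_def)
    have "set (as @ bs) = {..<r}"
    proof -
      have "insert 0 (Suc ` set (as @ bs)) = insert 0 (Suc ` {..<r})"
        using ys unfolding eq by (auto simp: insert0_def lessThan_Suc_eq_insert_0)
      then show ?thesis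
        by (metis (no_types, lifting) Diff_insert_absorb imageE inj_Suc inj_image_eq_iff nat.distinct(1))
    qed
    moreover have "distinct (as @ bs)"
      using ys unfolding eq by (auto simp: insert0_def distinct_map)
    ultimately show "ys \<in> ?l" using eq by auto
  qed
qed

text \<open>The gap edge gives way to two edges from \<open>0\<close> to its endpoints; every other
  edge is only renumbered.\<close>

lemma set_steps_insert0:
  "set (steps (Suc r # insert0 (as, bs) @ [Suc r])) =
     (`) Suc ` (set (steps (r # as)) \<union> set (steps (bs @ [r]))) \<union> (\<lambda>j. {0, Suc j}) ` gap r as bs"
proof -
  have *: "Suc r # map Suc as = map Suc (r # as)" "map Suc bs @ [Suc r] = map Suc (bs @ [r])"
    by simp_all
  have "hd (map Suc (bs @ [r])) = Suc (hd (bs @ [r]))"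
    by (rule hd_map) simp
  moreover have "last (map Suc (r # as)) = Suc (last (r # as))"
    by (rule last_map) simp
  moreover have "steps (Suc r # insert0 (as, bs) @ [Suc r]) = steps (map Suc (r # as)) @
     {last (map Suc (r # as)), 0} # {0, hd (map Suc (bs @ [r]))} # steps (map Suc (bs @ [r]))"
    using steps_append[of "map Suc (r # as)" "0 # map Suc (bs @ [r])"]
      steps_append[of "[0]" "map Suc (bs @ [r])"]
    by (simp add: insert0_def)
  ultimately show ?thesis
    unfolding steps_map by (auto simp: gap_def image_Un)
qed

text \<open>Both inclusions in \<open>rooted\<close> split into edges at \<open>0\<close> and
  renumbered edges. The former constrain only the endpoints of the gap, giving
  \<open>gaps L\<close>; the latter say that the smaller cycle is admissible with the gap as a
  further link.\<close>

lemma insert0_in_rooted_iff: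
  assumes L: "\<And>e. e \<in> L \<Longrightarrow> card e = 2" and r: "r \<ge> 2"
    and ab: "distinct (as @ bs)" "set (as @ bs) = {..<r}"
  shows "insert0 (as, bs) \<in> rooted (Suc r) L \<longleftrightarrow>
    gap r as bs \<in> gaps L \<and> as @ bs \<in> rooted r (insert (gap r as bs) (shift L))"
proof -
  \<comment> \<open>The edges of the smaller cycle apart from the gap.\<close>
  define R where "R = set (steps (r # as)) \<union> set (steps (bs @ [r]))"
  let ?g = "gap r as bs"
  let ?S = "set (steps (Suc r # insert0 (as, bs) @ [Suc r]))"
  have dist: "distinct (r # as @ bs)" using ab by auto
  have len: "length (as @ bs) \<ge> 2" using ab r by (metis card_lessThan distinct_card)
  have S: "?S = (`) Suc ` R \<union> (\<lambda>j. {0, Suc j}) ` ?g"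
    unfolding R_def by (rule set_steps_insert0)
  have gR: "?g \<notin> R"
    using distinct_steps_closed[OF dist len] unfolding steps_gap R_def by auto
  have S': "set (steps (r # (as @ bs) @ [r])) = insert ?g R"
    unfolding steps_gap R_def by auto
  have g2: "card ?g = 2" using card_gap[OF dist] len by fastforce
  have R2: "card e = 2" if "e \<in> R" for e
    using that dist card_steps[of "r # as"] card_steps[of "bs @ [r]"] by (auto simp: R_def)
  have zS: "{0, Suc j} \<in> ?S \<longleftrightarrow> j \<in> ?g" for j
    unfolding S by (auto simp: doubleton_eq_iff)
  have iS: "Suc ` f \<in> ?S \<longleftrightarrow> f \<in> R" for f
    unfolding S by (auto simp: inj_image_eq_iff)
  have lower: "L \<subseteq> ?S \<longleftrightarrow> nbr L \<subseteq> ?g \<and> shift L \<subseteq> R"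
  proof
    assume "L \<subseteq> ?S"
    then show "nbr L \<subseteq> ?g \<and> shift L \<subseteq> R" by (auto simp: nbr_def shift_def iS simp flip: zS)
  next
    assume *: "nbr L \<subseteq> ?g \<and> shift L \<subseteq> R"
    show "L \<subseteq> ?S"
    proof
      fix e assume e: "e \<in> L"
      from L[OF e] show "e \<in> ?S"
        by (cases rule: two_subset_cases) (use e * in \<open>auto simp: nbr_def shift_def iS zS\<close>)
    qed
  qed
  have "{0, Suc j} \<in> edges \<union> L \<longleftrightarrow> j \<in> {0, 3} \<union> nbr L" for j
    using zero_edge_iff[of j] by (auto simp: nbr_def)
  then have "(\<lambda>j. {0, Suc j}) ` ?g \<subseteq> edges \<union> L \<longleftrightarrow> ?g \<subseteq> {0, 3} \<union> nbr L"
    by blast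
  moreover have "Suc ` e \<in> edges \<union> L \<longleftrightarrow> e \<in> edges \<union> shift L" if "e \<in> R" for e
    using Suc_image_edges[OF R2[OF that]] by (simp add: shift_def)
  then have "(`) Suc ` R \<subseteq> edges \<union> L \<longleftrightarrow> R \<subseteq> edges \<union> shift L"
    by blast
  ultimately have upper:
    "?S \<subseteq> edges \<union> L \<longleftrightarrow> R \<subseteq> edges \<union> shift L \<and> ?g \<subseteq> {0, 3} \<union> nbr L"
    by (simp only: S Un_subset_iff)
  have "distinct (insert0 (as, bs)) \<and> set (insert0 (as, bs)) = {..<Suc r}"
    using bij_betw_apply[OF bij_insert0[of r], of "(as, bs)"] ab by blast
  then have "insert0 (as, bs) \<in> rooted (Suc r) L \<longleftrightarrow> L \<subseteq> ?S \<and> ?S \<subseteq> edges \<union> L"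
    unfolding rooted_def mem_Collect_eq by blast
  \<comment> \<open>The condition in \<open>gaps L\<close> that the gap avoid \<open>shift L\<close>
    comes from \<open>shift L \<subseteq> R\<close>, since \<open>R\<close> misses the gap.\<close>
  also have "\<dots> \<longleftrightarrow> ?g \<in> gaps L \<and> shift L \<subseteq> R \<and> R \<subseteq> edges \<union> shift L"
    unfolding lower upper gaps_def using gR g2 by blast
  also have "\<dots> \<longleftrightarrow> ?g \<in> gaps L \<and> as @ bs \<in> rooted r (insert ?g (shift L))"
  proof (rule conj_cong[OF refl])
    assume "?g \<in> gaps L"
    \<comment> \<open>The gap lies neither in \<open>shift L\<close> nor in \<open>R\<close>, so
      adding it on both sides changes neither inclusion.\<close>
    then have "?g \<notin> shift L" by (simp add: gaps_def)
    then have "shift L \<subseteq> R \<longleftrightarrow> insert ?g (shift L) \<subseteq> insert ?g R" by blast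
    moreover have "R \<subseteq> edges \<union> shift L \<longleftrightarrow> insert ?g R \<subseteq> edges \<union> insert ?g (shift L)"
      using gR by blast
    ultimately show "shift L \<subseteq> R \<and> R \<subseteq> edges \<union> shift L \<longleftrightarrow>
        as @ bs \<in> rooted r (insert ?g (shift L))"
      unfolding rooted_def mem_Collect_eq S' using ab by simp
  qed
  finally show ?thesis .
qed

lemma finite_rooted: "finite (rooted r L)"
proof (rule finite_subset)
  show "rooted r L \<subseteq> {ys. set ys \<subseteq> {..<r} \<and> length ys = r}"
    by (auto simp: rooted_def dest: distinct_card)
  show "finite {ys. set ys \<subseteq> {..<r} \<and> length ys = r}"
    by (simp add: finite_lists_length_eq)
qed

text \<open>Cut words are counted twice: \<open>insert0\<close> matches them with the larger cycles,
  and recording the gap with the rejoined word matches them with the pairs that the sum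
  counts.\<close>

theorem card_rooted_Suc:
  assumes L: "\<And>e. e \<in> L \<Longrightarrow> card e = 2" and r: "r \<ge> 2" and fin: "finite (gaps L)"
  shows "card (rooted (Suc r) L) = (\<Sum>e\<in>gaps L. card (rooted r (insert e (shift L))))"
proof -
  define P where "P = {(as, bs). distinct (as @ bs) \<and> set (as @ bs) = {..<r} \<and>
    gap r as bs \<in> gaps L \<and> as @ bs \<in> rooted r (insert (gap r as bs) (shift L))}"
  have "bij_betw insert0 P (rooted (Suc r) L)"
  proof (rule bij_betw_subset[OF bij_insert0[of r]])
    show "P \<subseteq> {(as, bs). distinct (as @ bs) \<and> set (as @ bs) = {..<r}}"
      by (auto simp: P_def)
    show "insert0 ` P = rooted (Suc r) L"
    proof (intro equalityI subsetI)
      fix ys assume "ys \<in> insert0 ` P"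
      then show "ys \<in> rooted (Suc r) L"
        using insert0_in_rooted_iff[OF L r] by (auto simp: P_def)
    next
      fix ys assume ys: "ys \<in> rooted (Suc r) L"
      then have "ys \<in> insert0 ` {(as, bs). distinct (as @ bs) \<and> set (as @ bs) = {..<r}}"
        using bij_betw_imp_surj_on[OF bij_insert0[of r]] by (auto simp: rooted_def)
      with ys show "ys \<in> insert0 ` P"
        using insert0_in_rooted_iff[OF L r] by (fastforce simp: P_def)
    qed
  qed
  then have "card (rooted (Suc r) L) = card P" by (simp add: bij_betw_same_card)
  also have "bij_betw (\<lambda>(as, bs). (gap r as bs, as @ bs)) P
      (SIGMA e:gaps L. rooted r (insert e (shift L)))"
  proof (rule bij_betw_imageI)
    show "inj_on (\<lambda>(as, bs). (gap r as bs, as @ bs)) P"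
    proof (rule inj_onI, clarify)
      fix as bs as' bs'
      assume *: "(as, bs) \<in> P" "gap r as bs = gap r as' bs'" "as @ bs = as' @ bs'"
      from *(1) have ab: "distinct (as @ bs)" "set (as @ bs) = {..<r}" by (auto simp: P_def)
      then have "length (as @ bs) \<ge> 2" using r by (metis card_lessThan distinct_card)
      moreover have "distinct (r # as @ bs)" using ab by auto
      ultimately show "as = as' \<and> bs = bs'" using * by (intro gap_unique)
    qed
    show "(\<lambda>(as, bs). (gap r as bs, as @ bs)) ` P = (SIGMA e:gaps L. rooted r (insert e (shift L)))"
      (is "?l = ?r")
    proof (intro equalityI subsetI)
      fix p assume "p \<in> ?l"
      then show "p \<in> ?r" by (auto simp: P_def)
    next
      fix p assume "p \<in> ?r"
      then obtain e ys where p: "p = (e, ys)" "e \<in> gaps L" "ys \<in> rooted r (insert e (shift L))"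
        by auto
      \<comment> \<open>A prescribed link is always used, so it occurs as a step and marks a place
        to cut.\<close>
      then have "e \<in> set (steps (r # ys @ [r]))" by (auto simp: rooted_def)
      then obtain as bs where "ys = as @ bs" "gap r as bs = e" by (rule gap_exists)
      with p have "(as, bs) \<in> P" "p = (gap r as bs, as @ bs)" by (auto simp: P_def rooted_def)
      then show "p \<in> ?l" by force
    qed
  qed
  then have "card P = card (SIGMA e:gaps L. rooted r (insert e (shift L)))"
    by (rule bij_betw_same_card)
  also have "\<dots> = (\<Sum>e\<in>gaps L. card (rooted r (insert e (shift L))))"
    using fin finite_rooted by (intro card_SigmaI) auto
  finally show ?thesis .
qed

section \<open>Evaluating the recursion on concrete link sets\<close>

text \<open>A link at \<open>0\<close> is no image under \<open>Suc\<close> and drops out. Together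
  with \<open>nbr_insert\<close> this computes the next link set by rewriting.\<close>

lemma shift_insert:
  "shift (insert {i, j} L) = (if i = 0 \<or> j = 0 then shift L else insert {i - 1, j - 1} (shift L))"
proof (cases "i = 0 \<or> j = 0")
  case True
  moreover have "0 \<notin> Suc ` e" for e by simp
  ultimately have "Suc ` e \<noteq> {i, j}" for e by blast
  with True show ?thesis by (simp add: shift_def)
next
  case False
  then have "Suc ` e = {i, j} \<longleftrightarrow> e = {i - 1, j - 1}" for e
    using inj_image_eq_iff[OF inj_Suc, of e "{i - 1, j - 1}"] by simp
  then have "shift (insert {i, j} L) = insert {i - 1, j - 1} (shift L)"
    by (simp only: shift_def insert_iff Collect_disj_eq insert_def[of "{i - 1, j - 1}"])
  then show ?thesis unfolding if_not_P[OF False] .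
qed

lemma nbr_insert:
  "nbr (insert {i, j} L) =
     (if i = 0 \<and> j \<noteq> 0 then insert (j - 1) (nbr L)
      else if j = 0 \<and> i \<noteq> 0 then insert (i - 1) (nbr L) else nbr L)"
  unfolding nbr_def by (auto simp: doubleton_eq_iff)

lemma shift_empty: "shift {} = {}" and nbr_empty: "nbr {} = {}"
  by (auto simp: shift_def nbr_def)

text \<open>Only two neighbours are available to \<open>0\<close>, so both must be taken.\<close>

lemma gaps_free:
  assumes "nbr L \<subseteq> {0, 3}"
  shows "gaps L = {{0, 3}} - shift L"
proof -
  have "card e = 2 \<and> nbr L \<subseteq> e \<and> e \<subseteq> {0, 3} \<union> nbr L \<longleftrightarrow> e = {0, 3}" for e
    unfolding Un_absorb2[OF assms] using assms card_subset_eq[of "{0, 3}" e]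
    by (auto simp del: insert_subset)
  then show ?thesis by (simp only: gaps_def singleton_conv)
qed

text \<open>The link takes one of the two places at \<open>0\<close>; one of the two graph edges
  fills the other. This is the only source of branching.\<close>

lemma gaps_one_link:
  assumes "nbr L = {j}" "j \<notin> {0, 3}"
  shows "gaps L = {{0, j}, {j, 3}} - shift L"
proof -
  have "card e = 2 \<and> {j} \<subseteq> e \<and> e \<subseteq> {0, 3} \<union> {j} \<longleftrightarrow> e = {0, j} \<or> e = {j, 3}" for e
  proof
    assume e: "card e = 2 \<and> {j} \<subseteq> e \<and> e \<subseteq> {0, 3} \<union> {j}"
    then obtain x where "e = {j, x}" "x \<noteq> j"
      by (metis card_2_iff doubleton_eq_iff insert_subset insertE singletonD)
    with e show "e = {0, j} \<or> e = {j, 3}" by auto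
  qed (use assms(2) in auto)
  then show ?thesis
    by (simp only: gaps_def assms(1) Collect_disj_eq singleton_conv Un_insert_left Un_empty_left)
qed

text \<open>The links already fill both places at \<open>0\<close>.\<close>

lemma gaps_two_links:
  assumes "nbr L = {j, k}" "j \<noteq> k"
  shows "gaps L = {{j, k}} - shift L"
proof -
  have "card e = 2 \<and> {j, k} \<subseteq> e \<and> e \<subseteq> {0, 3} \<union> {j, k} \<longleftrightarrow> e = {j, k}" for e
    using assms(2) card_subset_eq[of e "{j, k}"] card_ge_0_finite[of e] by auto
  then show ?thesis by (simp only: gaps_def assms(1) singleton_conv)
qed

text \<open>On three vertices the only cycle is the triangle, read in two directions. Its edge
  \<open>{0, 2}\<close> is not in the graph and has to be a link.\<close>

lemma rooted_2:
  "rooted 2 L = (if {0, 2} \<in> L \<and> L \<subseteq> {{0, 1}, {0, 2}, {1, 2}} then {[0, 1], [1, 0]} else {})"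
proof -
  have words: "distinct ys \<and> set ys = {..<2} \<longleftrightarrow> ys \<in> {[0, 1], [1, 0]}" for ys :: "nat list"
  proof
    assume *: "distinct ys \<and> set ys = {..<2}"
    then have "length ys = 2" using distinct_card by fastforce
    then obtain x y where "ys = [x, y]"
      by (auto simp: numeral_2_eq_2 length_Suc_conv)
    moreover have "{..<2} = {0, 1::nat}" by auto
    ultimately show "ys \<in> {[0, 1], [1, 0]}" using * by (auto simp: doubleton_eq_iff)
  qed auto
  let ?T = "{{0, 1}, {0, 2}, {1, 2}} :: nat set set"
  have "{0, 1} \<in> edges" "{1, 2} \<in> edges" "{0, 2} \<notin> edges"
    by (simp_all add: edge_iff)
  then have T: "?T \<subseteq> edges \<union> L \<longleftrightarrow> {0, 2} \<in> L"
    by blast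
  have steps: "set (steps (2 # ys @ [2])) = ?T" if "ys \<in> {[0, 1], [1, 0]}" for ys :: "nat list"
    using that by (auto simp: insert_commute)
  have *: "ys \<in> rooted 2 L \<longleftrightarrow> ys \<in> {[0, 1], [1, 0]} \<and> {0, 2} \<in> L \<and> L \<subseteq> ?T" for ys
    unfolding rooted_def mem_Collect_eq conj_assoc[symmetric] words
    unfolding conj_assoc using steps[of ys] T by (metis (no_types, lifting))
  show ?thesis
  proof (cases "{0, 2} \<in> L \<and> L \<subseteq> ?T")
    case True
    show ?thesis unfolding if_P[OF True] using * True by blast
  next
    case False
    show ?thesis unfolding if_not_P[OF False] using * False by blast
  qed
qed

section \<open>The linear system of twelve counts\<close>

abbreviation count :: "nat \<Rightarrow> nat set set \<Rightarrow> nat" where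
  "count r L \<equiv> card (rooted r L)"

lemmas link_simps = shift_insert nbr_insert shift_empty nbr_empty doubleton_eq_iff

text \<open>The link sets are those reached from \<open>{}\<close> by repeated removal; the list is
  closed under it.\<close>

lemma count_step:
  assumes "r \<ge> 2"
  shows
    "count (Suc r) {} = count r {{0, 3}}"
    "count (Suc r) {{0, 3}} = count r {{0, 2}} + count r {{2, 3}}"
    "count (Suc r) {{0, 2}} = count r {{0, 1}} + count r {{1, 3}}"
    "count (Suc r) {{2, 3}} = count r {{0, 3}, {1, 2}}"
    "count (Suc r) {{0, 1}} = count r {{0, 3}}"
    "count (Suc r) {{1, 3}} = count r {{0, 3}, {0, 2}}"
    "count (Suc r) {{0, 3}, {1, 2}} = count r {{0, 2}, {0, 1}} + count r {{2, 3}, {0, 1}}"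
    "count (Suc r) {{0, 3}, {0, 2}} = count r {{1, 2}}"
    "count (Suc r) {{0, 2}, {0, 1}} = count r {{0, 1}}"
    "count (Suc r) {{2, 3}, {0, 1}} = count r {{0, 3}, {1, 2}}"
    "count (Suc r) {{1, 2}} = count r {{0, 3}, {0, 1}}"
    "count (Suc r) {{0, 3}, {0, 1}} = count r {{0, 2}}"
proof -
  have free: "count (Suc r) L = count r (insert {0, 3} (shift L))"
    if "\<forall>e\<in>L. card e = 2" "nbr L \<subseteq> {0, 3}" "{0, 3} \<notin> shift L" for L
  proof -
    have "gaps L = {{0, 3}}" using gaps_free[OF that(2)] that(3) by (simp add: Diff_triv)
    then show ?thesis using that(1) assms by (subst card_rooted_Suc) simp_all
  qed
  have one: "count (Suc r) L = count r (insert {0, j} (shift L)) + count r (insert {j, 3} (shift L))"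
    if "\<forall>e\<in>L. card e = 2" "nbr L = {j}" "j \<notin> {0, 3}" "{0, j} \<notin> shift L" "{j, 3} \<notin> shift L" for L j
  proof -
    have "gaps L = {{0, j}, {j, 3}}" using gaps_one_link[OF that(2,3)] that(4,5) by (simp add: Diff_triv)
    moreover have "{0, j} \<noteq> {j, 3}" using that(3) by (simp add: doubleton_eq_iff)
    ultimately show ?thesis using that(1) assms by (subst card_rooted_Suc) simp_all
  qed
  have two: "count (Suc r) L = count r (insert {j, k} (shift L))"
    if "\<forall>e\<in>L. card e = 2" "nbr L = {j, k}" "j \<noteq> k" "{j, k} \<notin> shift L" for L j k
  proof -
    have "gaps L = {{j, k}}" using gaps_two_links[OF that(2,3)] that(4) by (simp add: Diff_triv)
    then show ?thesis using that(1) assms by (subst card_rooted_Suc) simp_all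
  qed
  show "count (Suc r) {} = count r {{0, 3}}"
    by (subst free) (auto simp: link_simps)
  \<comment> \<open>Here and below, the numbers passed to \<open>one\<close> and \<open>two\<close>
    are the far ends of the links at \<open>0\<close>, lowered by one.\<close>
  show "count (Suc r) {{0, 3}} = count r {{0, 2}} + count r {{2, 3}}"
    by (subst one[of _ 2]) (auto simp: link_simps)
  show "count (Suc r) {{0, 2}} = count r {{0, 1}} + count r {{1, 3}}"
    by (subst one[of _ 1]) (auto simp: link_simps)
  show "count (Suc r) {{2, 3}} = count r {{0, 3}, {1, 2}}"
    by (subst free) (auto simp: link_simps)
  show "count (Suc r) {{0, 1}} = count r {{0, 3}}"
    by (subst free) (auto simp: link_simps)
  show "count (Suc r) {{1, 3}} = count r {{0, 3}, {0, 2}}"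
    by (subst free) (auto simp: link_simps)
  show "count (Suc r) {{0, 3}, {1, 2}} = count r {{0, 2}, {0, 1}} + count r {{2, 3}, {0, 1}}"
    by (subst one[of _ 2]) (auto simp: link_simps)
  show "count (Suc r) {{0, 3}, {0, 2}} = count r {{1, 2}}"
    by (subst two[of _ 1 2]) (auto simp: link_simps)
  show "count (Suc r) {{0, 2}, {0, 1}} = count r {{0, 1}}"
    by (subst two[of _ 0 1]) (auto simp: link_simps)
  show "count (Suc r) {{2, 3}, {0, 1}} = count r {{0, 3}, {1, 2}}"
    by (subst free) (auto simp: link_simps)
  show "count (Suc r) {{1, 2}} = count r {{0, 3}, {0, 1}}"
    by (subst free) (auto simp: link_simps)
  show "count (Suc r) {{0, 3}, {0, 1}} = count r {{0, 2}}"
    by (subst two[of _ 0 2]) (auto simp: link_simps)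
qed

lemma count_2:
  "count 2 {} = 0" "count 2 {{0, 3}} = 0" "count 2 {{0, 2}} = 2" "count 2 {{2, 3}} = 0"
  "count 2 {{0, 1}} = 0" "count 2 {{1, 3}} = 0" "count 2 {{0, 3}, {1, 2}} = 0"
  "count 2 {{0, 3}, {0, 2}} = 0" "count 2 {{0, 2}, {0, 1}} = 2" "count 2 {{2, 3}, {0, 1}} = 0"
  "count 2 {{1, 2}} = 0" "count 2 {{0, 3}, {0, 1}} = 0"
  by (simp_all add: rooted_2 doubleton_eq_iff)

text \<open>Stated for arbitrary sequences, so that the expansion treats the counts as opaque. The
  index is the largest vertex, one less than the number of vertices, and the values are twice the
  necklace numbers.\<close>

lemma linear_system:
  fixes a b c d e f g h i j k l :: "nat \<Rightarrow> nat"
  assumes step: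
    "\<And>r. r \<ge> 2 \<Longrightarrow> a (Suc r) = b r" "\<And>r. r \<ge> 2 \<Longrightarrow> b (Suc r) = c r + d r"
    "\<And>r. r \<ge> 2 \<Longrightarrow> c (Suc r) = e r + f r" "\<And>r. r \<ge> 2 \<Longrightarrow> d (Suc r) = g r"
    "\<And>r. r \<ge> 2 \<Longrightarrow> e (Suc r) = b r" "\<And>r. r \<ge> 2 \<Longrightarrow> f (Suc r) = h r"
    "\<And>r. r \<ge> 2 \<Longrightarrow> g (Suc r) = i r + j r" "\<And>r. r \<ge> 2 \<Longrightarrow> h (Suc r) = k r"
    "\<And>r. r \<ge> 2 \<Longrightarrow> i (Suc r) = e r" "\<And>r. r \<ge> 2 \<Longrightarrow> j (Suc r) = g r"
    "\<And>r. r \<ge> 2 \<Longrightarrow> k (Suc r) = l r" "\<And>r. r \<ge> 2 \<Longrightarrow> l (Suc r) = c r"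
  assumes base: "a 2 = 0" "b 2 = 0" "c 2 = 2" "d 2 = 0" "e 2 = 0" "f 2 = 0" "g 2 = 0" "h 2 = 0"
    "i 2 = 2" "j 2 = 0" "k 2 = 0" "l 2 = 0"
  shows "r \<ge> 15 \<Longrightarrow> a r = a (r - 3) + a (r - 5) + a (r - 7) + a (r - 8) + a (r - 9) +
      a (r - 10) + a (r - 11) + a (r - 13)"
    and "a 3 = 0" "a 4 = 2" "a 5 = 0" "a 6 = 2" "a 7 = 2" "a 8 = 2" "a 9 = 6" "a 10 = 4"
      "a 11 = 6" "a 12 = 12" "a 13 = 10" "a 14 = 20"
proof -
  \<comment> \<open>In the expansion of the recurrence down to \<open>m\<close>, everything cancels except \<open>a m\<close> and \<open>e m\<close>.\<close>
  have ae: "a r = e r" if r: "r \<ge> 2" for r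
  proof (cases "r = 2")
    case False
    then have "r = Suc (r - 1)" "r - 1 \<ge> 2" using r by simp_all
    then show ?thesis using step(1,5)[of "r - 1"] by simp
  qed (simp add: base)
  {
    assume "r \<ge> 15"
    \<comment> \<open>The deepest term is \<open>a (r - 13)\<close>, so all terms are expanded down
      to \<open>m = r - 13\<close>; the bound on \<open>r\<close> makes every step from
      \<open>m\<close> on valid.\<close>
    then obtain m where "r = m + 13" "m \<ge> 2" using that[of "r - 13"] by simp
    then show "a r = a (r - 3) + a (r - 5) + a (r - 7) + a (r - 8) + a (r - 9) +
        a (r - 10) + a (r - 11) + a (r - 13)"
      using ae[of m] by (simp add: eval_nat_numeral step)
  }
  show "a 3 = 0" "a 4 = 2" "a 5 = 0" "a 6 = 2" "a 7 = 2" "a 8 = 2" "a 9 = 6" "a 10 = 4"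
      "a 11 = 6" "a 12 = 12" "a 13 = 10" "a 14 = 20"
    by (simp_all add: eval_nat_numeral step base[unfolded numeral_2_eq_2])
qed

lemmas count_linear = linear_system
    [where a = "\<lambda>r. count r {}" and b = "\<lambda>r. count r {{0, 3}}" and c = "\<lambda>r. count r {{0, 2}}" and
      d = "\<lambda>r. count r {{2, 3}}" and e = "\<lambda>r. count r {{0, 1}}" and f = "\<lambda>r. count r {{1, 3}}" and
      g = "\<lambda>r. count r {{0, 3}, {1, 2}}" and h = "\<lambda>r. count r {{0, 3}, {0, 2}}" and
      i = "\<lambda>r. count r {{0, 2}, {0, 1}}" and
      j = "\<lambda>r. count r {{2, 3}, {0, 1}}" and k = "\<lambda>r. count r {{1, 2}}" and
      l = "\<lambda>r. count r {{0, 3}, {0, 1}}",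
     OF count_step count_2]

section \<open>Necklace words as closed words\<close>

lemma cyc_rotate1: "set (steps (rotate1 xs @ [hd (rotate1 xs)])) = set (steps (xs @ [hd xs]))"
proof (cases xs)
  case (Cons x zs)
  show ?thesis
  proof (cases "zs = []")
    case False
    then show ?thesis
      using steps_append[of "zs @ [x]" "[hd zs]"] steps_append[of "[x]" "zs @ [x]"]
      by (simp add: Cons)
  qed (simp add: Cons)
qed simp

lemma cyc_rotate: "set (steps (rotate k xs @ [hd (rotate k xs)])) = set (steps (xs @ [hd xs]))"
  by (induction k) (simp_all add: cyc_rotate1)

text \<open>Reversing \<open>x # zs @ [x]\<close> gives the closed word of
  \<open>x # rev zs\<close>, which is one rotation away from \<open>rev xs\<close>.\<close>

lemma cyc_rev: "set (steps (rev xs @ [hd (rev xs)])) = set (steps (xs @ [hd xs]))"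
proof (cases xs)
  case (Cons x zs)
  have "set (steps (rev xs @ [hd (rev xs)])) = set (steps (rev (x # zs @ [x])))"
    using cyc_rotate1[of "x # rev zs"] by (simp add: Cons)
  then show ?thesis unfolding set_steps_rev by (simp add: Cons)
qed simp

lemma set_cyc:
  assumes "xs \<noteq> []"
  shows "set (steps (xs @ [hd xs])) = {{xs ! i, xs ! ((i + 1) mod length xs)} |i. i < length xs}"
proof -
  have "steps (xs @ [hd xs]) ! i = {xs ! i, xs ! ((i + 1) mod length xs)}" if "i < length xs" for i
  proof (cases "Suc i = length xs")
    \<comment> \<open>At the last index \<open>mod\<close> wraps to 0, matching the appended
      \<open>hd xs\<close>.\<close>
    case True
    then show ?thesis using that assms by (subst steps_nth) (auto simp: nth_append hd_conv_nth)
  next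
    case False
    then show ?thesis using that assms by (subst steps_nth) (auto simp: nth_append)
  qed
  then show ?thesis by (force simp: set_conv_nth)
qed

declare One_nat_def [simp del]

lemma necklace_word_iff:
  "necklace_word 1 4 n xs \<longleftrightarrow>
     n \<ge> 3 \<and> distinct xs \<and> set xs = {..<n} \<and> set (steps (xs @ [hd xs])) \<subseteq> edges"
proof -
  have "(\<forall>i<n. \<bar>int (xs ! i) - int (xs ! ((i + 1) mod n))\<bar> \<in> {int 1, int 4}) \<longleftrightarrow>
      set (steps (xs @ [hd xs])) \<subseteq> edges"
    if n: "n \<ge> 3" "distinct xs" "set xs = {..<n}"
  proof -
    have len: "length xs = n" using n distinct_card by fastforce
    then have "xs \<noteq> []" using n(1) by auto
    then have "(\<forall>i<n. {xs ! i, xs ! ((i + 1) mod n)} \<in> edges) \<longleftrightarrow>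
        set (steps (xs @ [hd xs])) \<subseteq> edges"
      unfolding set_cyc[OF \<open>xs \<noteq> []\<close>] len by blast
    then show ?thesis by (simp add: edge_iff)
  qed
  then show ?thesis unfolding necklace_word_def atLeast0LessThan by blast
qed

lemma necklace_word_rotate: "necklace_word 1 4 n (rotate k xs) \<longleftrightarrow> necklace_word 1 4 n xs"
  by (simp add: necklace_word_iff cyc_rotate)

lemma necklace_word_Cons: "r \<ge> 2 \<Longrightarrow> necklace_word 1 4 (Suc r) (r # ys) \<longleftrightarrow> ys \<in> rooted r {}"
  by (auto simp: necklace_word_iff rooted_def lessThan_Suc)

section \<open>Rotation and reflection classes\<close>

lemma rev_rotate: "rev (rotate k xs) = rotate (length xs - k mod length xs) (rev xs)"
  by (metis length_rev rev_rev_ident rotate_rev)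

lemma rotate_inverse: "\<exists>j. rotate j (rotate k xs) = xs"
proof (cases "xs = []")
  case False
  have "rotate (length xs - k mod length xs + k) xs = xs"
    using False by (intro rotate_id) (metis add.commute le_add_diff_inverse length_greater_0_conv
      less_imp_le_nat mod_add_left_eq mod_less_divisor mod_self)
  then show ?thesis by (auto simp: rotate_rotate)
qed simp

lemma same_necklace_sym:
  assumes "same_necklace xs ys"
  shows "same_necklace ys xs"
proof -
  from assms consider k where "ys = rotate k xs" | k where "ys = rotate k (rev xs)"
    by (auto simp: same_necklace_def)
  then show ?thesis
  proof cases
    case 1
    then show ?thesis using rotate_inverse[of k xs] unfolding same_necklace_def by metis
  next
    case 2
    then obtain j where "rotate j ys = rev xs" using rotate_inverse by blast
    then have "xs = rev (rotate j ys)" by simp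
    then show ?thesis unfolding same_necklace_def rev_rotate by blast
  qed
qed

lemma same_necklace_trans:
  assumes "same_necklace xs ys" "same_necklace ys zs"
  shows "same_necklace xs zs"
proof -
  from assms obtain k m where "ys = rotate k xs \<or> ys = rotate k (rev xs)"
    "zs = rotate m ys \<or> zs = rotate m (rev ys)"
    unfolding same_necklace_def by blast
  then consider "zs = rotate m (rotate k xs)" | "zs = rotate m (rotate k (rev xs))"
    | "zs = rotate m (rev (rotate k xs))" | "zs = rotate m (rev (rotate k (rev xs)))"
    by blast
  then show ?thesis
    unfolding same_necklace_def rev_rotate rotate_rotate rev_rev_ident by cases blast+
qed

lemma same_necklace_refl: "same_necklace xs xs"
  unfolding same_necklace_def by (metis rotate0 id_apply)

lemma rotate_same_hd:
  assumes "distinct xs" "xs \<noteq> []" "hd (rotate k xs) = hd xs"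
  shows "rotate k xs = xs"
proof -
  have "xs ! (k mod length xs) = xs ! 0"
    using assms(3) hd_rotate_conv_nth[OF assms(2), of k] hd_conv_nth[OF assms(2)] by simp
  then have "k mod length xs = 0"
    using assms by (simp add: nth_eq_iff_index_eq)
  then show ?thesis by (rule rotate_id)
qed

text \<open>Fixing the first entry of a distinct word rules out proper rotations; only the
  reflection fixing \<open>r\<close> remains.\<close>

lemma same_necklace_Cons_iff:
  assumes "distinct (r # ys)" "zs \<noteq> []" "hd zs = r"
  shows "same_necklace (r # ys) zs \<longleftrightarrow> zs = r # ys \<or> zs = r # rev ys"
proof
  have rev: "rev (r # ys) = rotate (Suc 0) (r # rev ys)" by simp
  assume "same_necklace (r # ys) zs"
  then obtain k where "zs = rotate k (r # ys) \<or> zs = rotate k (r # rev ys)"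
    unfolding same_necklace_def rev by (metis rotate_rotate)
  then show "zs = r # ys \<or> zs = r # rev ys"
    using rotate_same_hd[of "r # ys" k] rotate_same_hd[of "r # rev ys" k] assms by auto
next
  assume "zs = r # ys \<or> zs = r # rev ys"
  moreover have "r # rev ys = rotate (length ys) (rev (r # ys))"
    using rotate_append[of "rev ys" "[r]"] by simp
  ultimately show "same_necklace (r # ys) zs"
    unfolding same_necklace_def by (metis rotate0 id_apply)
qed

text \<open>Otherwise the first and last entries would agree. This makes the two readings of a
  necklace different.\<close>

lemma rev_neq_self:
  assumes "distinct ys" "length ys \<ge> 2"
  shows "rev ys \<noteq> ys"
proof -
  obtain y z zs where "ys = y # z # zs"
    using assms(2) by (metis Suc_le_length_iff numeral_2_eq_2)
  with assms(1) show ?thesis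
    by (cases "z # zs" rule: rev_cases) auto
qed

text \<open>Every class contains exactly two words starting with \<open>r\<close>, namely
  \<open>r # ys\<close> and \<open>r # rev ys\<close>; summing over the disjoint classes gives the
  factor 2.\<close>

theorem count_rooted_eq:
  assumes r: "r \<ge> 2"
  shows "card (rooted r {}) = 2 * num_necklaces 1 4 (Suc r)"
proof -
  let ?nw = "necklace_word 1 4 (Suc r)"
  define W where "W = {xs. ?nw xs}"
  define S where "S = {(xs, ys). ?nw xs \<and> ?nw ys \<and> same_necklace xs ys}"
  define B where "B = (#) r ` rooted r {}"
  have B: "xs \<in> B \<longleftrightarrow> ?nw xs \<and> xs \<noteq> [] \<and> hd xs = r" for xs
    unfolding B_def using necklace_word_Cons[OF r] by (cases xs) auto
  have eq: "equiv W S"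
    by (rule equivI) (auto simp: W_def S_def refl_on_def sym_def trans_def same_necklace_refl
        intro: same_necklace_sym same_necklace_trans)
  have "W \<subseteq> {xs. set xs \<subseteq> {..<Suc r} \<and> length xs = Suc r}"
    by (auto simp: W_def necklace_word_iff dest: distinct_card)
  then have finW: "finite W"
    by (rule finite_subset) (simp add: finite_lists_length_eq)
  have two: "card (c \<inter> B) = 2" if "c \<in> W // S" for c
  proof -
    from that obtain xs where xs: "?nw xs" "c = S `` {xs}"
      by (auto simp: quotient_def W_def)
    then have "r \<in> set xs" by (auto simp: necklace_word_iff)
    \<comment> \<open>Rotating by the position of \<open>r\<close> yields a representative that
      starts with \<open>r\<close>.\<close>
    then obtain k where k: "k < length xs" "xs ! k = r" by (auto simp: in_set_conv_nth)
    moreover have "rotate k xs \<noteq> []" using k by auto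
    ultimately obtain ys where ys: "rotate k xs = r # ys"
      by (metis hd_rotate_conv_nth list.collapse mod_less rotate_is_Nil_conv)
    have nw: "?nw (r # ys)" using xs(1) necklace_word_rotate[of "Suc r" k xs] by (simp add: ys)
    then have dist: "distinct (r # ys)" and len: "length (r # ys) = Suc r"
      by (auto simp only: necklace_word_iff dest: distinct_card) (metis card_lessThan distinct_card)
    have "same_necklace xs (r # ys)" unfolding same_necklace_def ys[symmetric] by blast
    then have "(xs, r # ys) \<in> S" using xs(1) nw by (simp add: S_def)
    then have c: "c = S `` {r # ys}" using xs(2) equiv_class_eq[OF eq] by simp
    have nw': "?nw (r # rev ys)"
      using nw cyc_rev[of "r # ys"] cyc_rotate1[of "r # rev ys"] by (simp add: necklace_word_iff)
    have "c \<inter> B = {r # ys, r # rev ys}"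
      using nw nw' same_necklace_Cons_iff[OF dist] by (auto simp: c B S_def)
    moreover have "rev ys \<noteq> ys" using rev_neq_self[of ys] dist len r by simp
    ultimately show ?thesis by simp
  qed
  have "B = (\<Union>c\<in>W // S. c \<inter> B)"
    using Union_quotient[OF eq] by (auto simp: B W_def)
  also have "card \<dots> = (\<Sum>c\<in>W // S. card (c \<inter> B))"
  proof (rule card_UN_disjoint)
    show "finite (W // S)"
      using finW by (rule finite_quotient) (auto simp: S_def W_def)
    show "\<forall>c\<in>W // S. finite (c \<inter> B)"
      using finite_rooted by (auto simp: B_def)
    show "\<forall>c\<in>W // S. \<forall>c'\<in>W // S. c \<noteq> c' \<longrightarrow> (c \<inter> B) \<inter> (c' \<inter> B) = {}"
      using quotient_disj[OF eq] by blast
  qed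
  also have "\<dots> = 2 * card (W // S)" using two by simp
  also have "W // S = necklaces 1 4 (Suc r)" by (simp add: necklaces_def W_def S_def)
  finally show ?thesis by (simp add: B_def card_image num_necklaces_def)
qed

section \<open>The recurrence and its initial values\<close>

theorem mainTheorem6:
  shows "(\<forall>n\<ge>16. num_necklaces 1 4 n =
            num_necklaces 1 4 (n - 3) + num_necklaces 1 4 (n - 5) +
            num_necklaces 1 4 (n - 7) + num_necklaces 1 4 (n - 8) +
            num_necklaces 1 4 (n - 9) + num_necklaces 1 4 (n - 10) +
            num_necklaces 1 4 (n - 11) + num_necklaces 1 4 (n - 13)) \<and>
         (\<forall>n<5. num_necklaces 1 4 n = 0) \<and>
         num_necklaces 1 4 5 = 1 \<and>
         num_necklaces 1 4 6 = 0 \<and>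
         num_necklaces 1 4 7 = 1 \<and>
         num_necklaces 1 4 8 = 1 \<and>
         num_necklaces 1 4 9 = 1 \<and>
         num_necklaces 1 4 10 = 3 \<and>
         num_necklaces 1 4 11 = 2 \<and>
         num_necklaces 1 4 12 = 3 \<and>
         num_necklaces 1 4 13 = 6 \<and>
         num_necklaces 1 4 14 = 5 \<and>
         num_necklaces 1 4 15 = 10"
proof -
  let ?N = "num_necklaces 1 4"
  have N: "count (n - 1) {} = 2 * ?N n" if "n \<ge> 3" for n
    using count_rooted_eq[of "n - 1"] that by simp
  have "?N n = ?N (n - 3) + ?N (n - 5) + ?N (n - 7) + ?N (n - 8) + ?N (n - 9) + ?N (n - 10) +
      ?N (n - 11) + ?N (n - 13)" if "n \<ge> 16" for n
  proof -
    \<comment> \<open>As \<open>n - k\<close> is at least 3, every term of the recurrence is half of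
      a rooted count.\<close>
    have shift: "count (n - 1 - k) {} = 2 * ?N (n - k)" if "k \<le> 13" for k
      using N[of "n - k"] that \<open>n \<ge> 16\<close> by (simp add: add.commute)
    show ?thesis
      using count_linear(1)[of "n - 1"] shift[of 0] shift[of 3] shift[of 5] shift[of 7] shift[of 8]
        shift[of 9] shift[of 10] shift[of 11] shift[of 13] that
      by simp
  qed
  moreover have "?N n = 0" if "n < 5" for n
  proof -
    consider "n < 3" | "n = 3" | "n = 4" using \<open>n < 5\<close> by linarith
    then show ?thesis
    proof cases
      \<comment> \<open>Below length 3 there are no necklace words by definition; lengths 3 and 4
        are read off the counts.\<close>
      case 1
      then show ?thesis
        by (simp add: num_necklaces_def necklaces_def necklace_word_def quotient_def)
    qed (use N[of n] count_2(1) count_linear(2) in simp_all)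
  qed
  ultimately show ?thesis
    using count_linear(3-13) N[of 5] N[of 6] N[of 7] N[of 8] N[of 9] N[of 10] N[of 11] N[of 12]
      N[of 13] N[of 14] N[of 15] by simp
qed

end
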